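(* Let $\ell^{n}=\{M,H\}$ be a Cartan space with $(\alpha,\beta)$-metric whose fundamental function is $H(\alpha,\beta)=\dfrac{\alpha\beta^{2}}{\beta-\alpha}$, considered on the region $U\subset T^{*}M\setminus\{0\}$. Then the invariants $r_{-1},r_{-2},r_{-3},r_{-4}$ of its Cartan tensor $C^{ijk}$ are $$r_{-1}=\frac{-3\alpha^{3}}{(\beta-\alpha)^{4}},\qquad r_{-2}=\frac{3\alpha\beta}{(\beta-\alpha)^{4}},$$ $$r_{-3}=\frac{4\alpha\beta^{3}-\beta^{4}-9\alpha^{2}\beta^{2}}{2\alpha^{3}(\beta-\alpha)^{4}},\qquad r_{-4}=\frac{15\alpha^{2}\beta^{3}+3\beta^{5}-12\alpha\beta^{4}}{2\alpha^{5}(\beta-\alpha)^{4}}.$$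
   Context: $M$ is an $n$-dimensional smooth manifold, $(x,y)=(x^i,y_i)$ are the canonical coordinates on $T^{*}M$, and summation over repeated indices is understood. $a^{ij}(x)$ is a (contravariant) Riemannian metric on $M$, $b^{i}(x)$ a vector field on $M$, $\alpha(x,y)=\sqrt{a^{ij}(x)y_iy_j}$, $\beta(x,y)=b^{i}(x)y_i$, and $Y^{i}=a^{ij}y_j$. $U$ denotes the region of $T^{*}M\setminus\{0\}$ (zero section removed) where $\beta>0$ and $\alpha<\beta$. A Cartan space $\ell^{n}=\{M,H(x,y)\}$ is given by a fundamental function $H(x,y)$ positively homogeneous of degree $2$ in $y$ whose fundamental tensor $g^{ij}=\frac12\frac{\partial^2 H}{\partial y_i\partial y_j}$ is nondegenerate. It is a Cartan space with $(\alpha,\beta)$-metric if $H(x,y)=H(\alpha(x,y),\beta(x,y))$ is a function of $\alpha$ and $\beta$ only. Its Cartan tensor is $C^{ijk}=-\frac12\frac{\partial g^{ij}}{\partial y_k}$. Subscripts on $H$ denote partial derivatives of $H(\alpha,\beta)$. The invariants $r_{-1},\dots,r_{-4}$ (the coefficients of $b^ib^jb^k$, $b^ib^jY^k$, $b^iY^jY^k$, $Y^iY^jY^k$, up to cyclic symmetrization, in $-2C^{ijk}$) are $$r_{-1}=\tfrac12H_{\beta\beta\beta},\quad r_{-2}=\tfrac{1}{2\alpha}H_{\alpha\beta\beta},\quad r_{-3}=\tfrac{1}{2\alpha^{2}}\left(H_{\alpha\alpha\beta}-\alpha^{-1}H_{\alpha\beta}\right),\quad r_{-4}=\tfrac{1}{2\alpha^{3}}\left(H_{\alpha\alpha\alpha}-3\alpha^{-1}H_{\alpha\alpha}+3\alpha^{-2}H_{\alpha}\right).$$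 *)

theory Defs
  imports "HOL-Analysis.Analysis"
begin

section \<open>Smooth manifolds and tensor fields in local coordinates\<close>

primrec C_k_on :: "nat \<Rightarrow> ('a::euclidean_space \<Rightarrow> 'b::real_normed_vector) \<Rightarrow> 'a set \<Rightarrow> bool" where
  "C_k_on 0 f S \<longleftrightarrow> continuous_on S f"
| "C_k_on (Suc k) f S \<longleftrightarrow> f differentiable_on S \<and>
     (\<forall>e\<in>Basis. C_k_on k (\<lambda>x. frechet_derivative f (at x) e) S)"

definition smooth_on :: "('a::euclidean_space \<Rightarrow> 'b::real_normed_vector) \<Rightarrow> 'a set \<Rightarrow> bool" where
  "smooth_on f S \<longleftrightarrow> open S \<and> (\<forall>k. C_k_on k f S)"

text \<open>A chart is a pair of its domain and its coordinate map.\<close>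

type_synonym ('m, 'n) chart = "'m set \<times> ('m \<Rightarrow> real^'n)"

definition point_at :: "('m, 'n) chart \<Rightarrow> real^'n \<Rightarrow> 'm" where
  "point_at c = inv_into (fst c) (snd c)"

text \<open>The manifold is the whole type \<open>'m\<close>, and \<open>n\<close> is \<open>CARD('n)\<close>. The atlas need not be maximal.\<close>

definition smooth_atlas ::
    "('m::{t2_space, second_countable_topology}, 'n::finite) chart set \<Rightarrow> bool" where
  "smooth_atlas A \<longleftrightarrow>
     (\<Union>c\<in>A. fst c) = UNIV \<and>
     (\<forall>c\<in>A. open (fst c) \<and> open (snd c ` fst c) \<and>
        homeomorphism (fst c) (snd c ` fst c) (snd c) (point_at c)) \<and>
     (\<forall>c\<in>A. \<forall>d\<in>A. smooth_on (snd d \<circ> point_at c) (snd c ` (fst c \<inter> fst d)))"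

text \<open>The entry at \<open>(i, j)\<close> is the derivative of the \<open>i\<close>-th coordinate of \<open>d\<close> in the
  direction of the \<open>j\<close>-th coordinate of \<open>c\<close>.\<close>

definition jacobian :: "('m, 'n::finite) chart \<Rightarrow> ('m, 'n) chart \<Rightarrow> 'm \<Rightarrow> real^'n^'n" where
  "jacobian c d p = matrix (frechet_derivative (snd d \<circ> point_at c) (at (snd c p)))"

text \<open>Tensor fields are families of components, one for each chart, obeying the transformation law.\<close>

definition smooth_vector_field ::
    "('m, 'n::finite) chart set \<Rightarrow> (('m, 'n) chart \<Rightarrow> 'm \<Rightarrow> real^'n) \<Rightarrow> bool" where
  "smooth_vector_field A b \<longleftrightarrow>
     (\<forall>c\<in>A. smooth_on (b c \<circ> point_at c) (snd c ` fst c)) \<and>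
     (\<forall>c\<in>A. \<forall>d\<in>A. \<forall>p \<in> fst c \<inter> fst d. b d p = jacobian c d p *v b c p)"

definition contravariant_riemannian_metric ::
    "('m, 'n::finite) chart set \<Rightarrow> (('m, 'n) chart \<Rightarrow> 'm \<Rightarrow> real^'n^'n) \<Rightarrow> bool" where
  "contravariant_riemannian_metric A a \<longleftrightarrow>
     (\<forall>c\<in>A. smooth_on (a c \<circ> point_at c) (snd c ` fst c)) \<and>
     (\<forall>c\<in>A. \<forall>d\<in>A. \<forall>p \<in> fst c \<inter> fst d.
        a d p = jacobian c d p ** a c p ** transpose (jacobian c d p)) \<and>
     (\<forall>c\<in>A. \<forall>p \<in> fst c. transpose (a c p) = a c p \<and>
        (\<forall>y. y \<noteq> 0 \<longrightarrow> y \<bullet> (a c p *v y) > 0))"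


section \<open>Cartan spaces\<close>

text \<open>A covector over a chart \<open>c\<close> is given by its base point \<open>p\<close> and its components \<open>y\<close>, where
  \<open>(snd c p, y)\<close> are the canonical coordinates of the cotangent bundle. The same covector has
  components \<open>transpose (jacobian c d p) *v y\<close> in \<open>c\<close> if it has components \<open>y\<close> in \<open>d\<close>.
  Subsets of the cotangent bundle, and functions on them, are families over the charts that are
  compatible with this change of coordinates.\<close>

definition open_conic_region ::
    "('m, 'n::finite) chart set \<Rightarrow> (('m, 'n) chart \<Rightarrow> ('m \<times> (real^'n)) set) \<Rightarrow> bool" where
  "open_conic_region A D \<longleftrightarrow>
     (\<forall>c\<in>A. D c \<subseteq> fst c \<times> (UNIV - {0}) \<and>
        open ((\<lambda>(p, y). (snd c p, y)) ` D c) \<and>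
        (\<forall>(p, y) \<in> D c. \<forall>t>0. (p, t *\<^sub>R y) \<in> D c)) \<and>
     (\<forall>c\<in>A. \<forall>d\<in>A. \<forall>p \<in> fst c \<inter> fst d. \<forall>y.
        (p, y) \<in> D d \<longleftrightarrow> (p, transpose (jacobian c d p) *v y) \<in> D c)"

definition partial :: "'n::finite \<Rightarrow> (real^'n \<Rightarrow> real) \<Rightarrow> real^'n \<Rightarrow> real" where
  "partial i f y = deriv (\<lambda>t. f (y + t *\<^sub>R axis i 1)) 0"

text \<open>For \<open>F = H c p\<close>, the fundamental function in a cotangent space, as a function of the
  components \<open>y\<close>.\<close>

definition fundamental_tensor :: "(real^'n \<Rightarrow> real) \<Rightarrow> real^'n \<Rightarrow> real^'n::finite^'n" where
  "fundamental_tensor F y = (\<chi> i j. 1 / 2 * partial i (partial j F) y)"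

definition cartan_tensor ::
    "(real^'n \<Rightarrow> real) \<Rightarrow> real^'n \<Rightarrow> 'n \<Rightarrow> 'n \<Rightarrow> 'n::finite \<Rightarrow> real" where
  "cartan_tensor F y i j k = - (1 / 2) * partial k (\<lambda>z. fundamental_tensor F z $ i $ j) y"

definition cartan_space_on ::
    "('m, 'n::finite) chart set \<Rightarrow> (('m, 'n) chart \<Rightarrow> ('m \<times> (real^'n)) set) \<Rightarrow>
     (('m, 'n) chart \<Rightarrow> 'm \<Rightarrow> real^'n \<Rightarrow> real) \<Rightarrow> bool" where
  "cartan_space_on A D H \<longleftrightarrow>
     open_conic_region A D \<and>
     (\<forall>c\<in>A. \<forall>d\<in>A. \<forall>p \<in> fst c \<inter> fst d. \<forall>y. (p, y) \<in> D d \<longrightarrow>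
        H c p (transpose (jacobian c d p) *v y) = H d p y) \<and>
     (\<forall>c\<in>A. smooth_on (\<lambda>(x, y). H c (point_at c x) y) ((\<lambda>(p, y). (snd c p, y)) ` D c)) \<and>
     (\<forall>c\<in>A. \<forall>(p, y) \<in> D c. \<forall>t>0. H c p (t *\<^sub>R y) = t\<^sup>2 * H c p y) \<and>
     (\<forall>c\<in>A. \<forall>(p, y) \<in> D c. invertible (fundamental_tensor (H c p) y))"


section \<open>Cartan spaces with an alpha-beta metric\<close>

definition alpha ::
    "(('m, 'n::finite) chart \<Rightarrow> 'm \<Rightarrow> real^'n^'n) \<Rightarrow> ('m, 'n) chart \<Rightarrow> 'm \<Rightarrow> real^'n \<Rightarrow> real" where
  "alpha a c p y = sqrt (\<Sum>i\<in>UNIV. \<Sum>j\<in>UNIV. a c p $ i $ j * y $ i * y $ j)"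

definition beta ::
    "(('m, 'n::finite) chart \<Rightarrow> 'm \<Rightarrow> real^'n) \<Rightarrow> ('m, 'n) chart \<Rightarrow> 'm \<Rightarrow> real^'n \<Rightarrow> real" where
  "beta b c p y = (\<Sum>i\<in>UNIV. b c p $ i * y $ i)"

definition region_U ::
    "(('m, 'n::finite) chart \<Rightarrow> 'm \<Rightarrow> real^'n^'n) \<Rightarrow> (('m, 'n) chart \<Rightarrow> 'm \<Rightarrow> real^'n) \<Rightarrow>
     ('m, 'n) chart \<Rightarrow> ('m \<times> (real^'n)) set" where
  "region_U a b c =
     {(p, y). p \<in> fst c \<and> y \<noteq> 0 \<and> beta b c p y > 0 \<and> alpha a c p y < beta b c p y}"

definition alpha_beta_cartan_space_on ::
    "('m, 'n::finite) chart set \<Rightarrow> (('m, 'n) chart \<Rightarrow> 'm \<Rightarrow> real^'n^'n) \<Rightarrow>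
     (('m, 'n) chart \<Rightarrow> 'm \<Rightarrow> real^'n) \<Rightarrow> (('m, 'n) chart \<Rightarrow> ('m \<times> (real^'n)) set) \<Rightarrow>
     (real \<Rightarrow> real \<Rightarrow> real) \<Rightarrow> (('m, 'n) chart \<Rightarrow> 'm \<Rightarrow> real^'n \<Rightarrow> real) \<Rightarrow> bool" where
  "alpha_beta_cartan_space_on A a b D h H \<longleftrightarrow>
     cartan_space_on A D H \<and>
     (\<forall>c\<in>A. \<forall>(p, y) \<in> D c. H c p y = h (alpha a c p y) (beta b c p y))"

definition d_alpha :: "(real \<Rightarrow> real \<Rightarrow> real) \<Rightarrow> real \<Rightarrow> real \<Rightarrow> real" where
  "d_alpha h \<alpha> \<beta> = deriv (\<lambda>s. h s \<beta>) \<alpha>"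

definition d_beta :: "(real \<Rightarrow> real \<Rightarrow> real) \<Rightarrow> real \<Rightarrow> real \<Rightarrow> real" where
  "d_beta h \<alpha> \<beta> = deriv (\<lambda>t. h \<alpha> t) \<beta>"

definition r_m1 :: "(real \<Rightarrow> real \<Rightarrow> real) \<Rightarrow> real \<Rightarrow> real \<Rightarrow> real" where
  "r_m1 h \<alpha> \<beta> = 1 / 2 * d_beta (d_beta (d_beta h)) \<alpha> \<beta>"

definition r_m2 :: "(real \<Rightarrow> real \<Rightarrow> real) \<Rightarrow> real \<Rightarrow> real \<Rightarrow> real" where
  "r_m2 h \<alpha> \<beta> = 1 / (2 * \<alpha>) * d_beta (d_beta (d_alpha h)) \<alpha> \<beta>"

definition r_m3 :: "(real \<Rightarrow> real \<Rightarrow> real) \<Rightarrow> real \<Rightarrow> real \<Rightarrow> real" where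
  "r_m3 h \<alpha> \<beta> = 1 / (2 * \<alpha>^2) *
     (d_beta (d_alpha (d_alpha h)) \<alpha> \<beta> - 1 / \<alpha> * d_beta (d_alpha h) \<alpha> \<beta>)"

definition r_m4 :: "(real \<Rightarrow> real \<Rightarrow> real) \<Rightarrow> real \<Rightarrow> real \<Rightarrow> real" where
  "r_m4 h \<alpha> \<beta> = 1 / (2 * \<alpha>^3) *
     (d_alpha (d_alpha (d_alpha h)) \<alpha> \<beta> - 3 / \<alpha> * d_alpha (d_alpha h) \<alpha> \<beta>
      + 3 / \<alpha>^2 * d_alpha h \<alpha> \<beta>)"

text \<open>The functions \<open>r1\<close>, ..., \<open>r4\<close> of alpha and beta are the coefficients of the terms in
  \<open>b\<close> and \<open>Y\<close> alone in the expansion of \<open>-2\<close> times the Cartan tensor. Differentiating alpha twice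
  also produces terms in \<open>a\<close>, which carry two further coefficients \<open>\<rho>\<close> and \<open>\<sigma>\<close>.\<close>

definition cartan_tensor_coefficients ::
    "('m, 'n::finite) chart set \<Rightarrow> (('m, 'n) chart \<Rightarrow> 'm \<Rightarrow> real^'n^'n) \<Rightarrow>
     (('m, 'n) chart \<Rightarrow> 'm \<Rightarrow> real^'n) \<Rightarrow> (('m, 'n) chart \<Rightarrow> ('m \<times> (real^'n)) set) \<Rightarrow>
     (('m, 'n) chart \<Rightarrow> 'm \<Rightarrow> real^'n \<Rightarrow> real) \<Rightarrow>
     (real \<Rightarrow> real \<Rightarrow> real) \<Rightarrow> (real \<Rightarrow> real \<Rightarrow> real) \<Rightarrow> (real \<Rightarrow> real \<Rightarrow> real) \<Rightarrow>
     (real \<Rightarrow> real \<Rightarrow> real) \<Rightarrow> bool" where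
  "cartan_tensor_coefficients A a b D H r1 r2 r3 r4 \<longleftrightarrow>
     (\<exists>\<rho> \<sigma>. \<forall>c\<in>A. \<forall>(p, y) \<in> D c. \<forall>i j k.
        let \<alpha> = alpha a c p y; \<beta> = beta b c p y;
            M = (\<lambda>i j. a c p $ i $ j); B = (\<lambda>i. b c p $ i); Y = (\<lambda>i. (a c p *v y) $ i)
        in - 2 * cartan_tensor (H c p) y i j k =
             r1 \<alpha> \<beta> * (B i * B j * B k)
           + r2 \<alpha> \<beta> * (B i * B j * Y k + B j * B k * Y i + B k * B i * Y j)
           + r3 \<alpha> \<beta> * (B i * Y j * Y k + B j * Y k * Y i + B k * Y i * Y j)
           + r4 \<alpha> \<beta> * (Y i * Y j * Y k)
           + \<rho> \<alpha> \<beta> * (M i j * B k + M j k * B i + M k i * B j)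
           + \<sigma> \<alpha> \<beta> * (M i j * Y k + M j k * Y i + M k i * Y j))"

end

theory Submission
  imports Defs
begin

text \<open>Along a line in a cotangent space, \<open>\<alpha>\<close> has derivative \<open>Y\<^sup>k / \<alpha>\<close>, \<open>Y\<^sup>i\<close> has derivative \<open>a\<^sup>i\<^sup>k\<close>
  and \<open>\<beta>\<close> has derivative \<open>b\<^sup>k\<close>. Three applications of the chain rule to \<open>h(\<alpha>, \<beta>)\<close> therefore give the
  expansion of the Cartan tensor for every three times differentiable \<open>h\<close>, with
  \<open>\<rho> = h\<^sub>\<alpha>\<^sub>\<beta> / (2\<alpha>)\<close> and \<open>\<sigma> = (h\<^sub>\<alpha>\<^sub>\<alpha> - h\<^sub>\<alpha> / \<alpha>) / (2\<alpha>\<^sup>2)\<close> as the coefficients of the terms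
  containing \<open>a\<close>. The closed forms of the invariants follow from the partial derivatives of
  \<open>\<alpha>\<beta>\<^sup>2 / (\<beta> - \<alpha>)\<close>.\<close>

section \<open>Calculus of functions of two real variables\<close>

text \<open>Total differentiability with gradient \<open>(fa, fb)\<close> is demanded at each point
  of \<open>W\<close>, since existence of the two partial derivatives alone would not give the chain
  rule along curves.\<close>

definition has_partials ::
    "(real \<Rightarrow> real \<Rightarrow> real) \<Rightarrow> (real \<Rightarrow> real \<Rightarrow> real) \<Rightarrow> (real \<Rightarrow> real \<Rightarrow> real) \<Rightarrow>
     (real \<times> real) set \<Rightarrow> bool" where
  "has_partials f fa fb W \<longleftrightarrow>
     (\<forall>s t. (s, t) \<in> W \<longrightarrow>
        ((\<lambda>z. f (fst z) (snd z)) has_derivative (\<lambda>v. fa s t * fst v + fb s t * snd v)) (at (s, t)))"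

lemma has_partials_chain:
  assumes "has_partials f fa fb W" "(x t, y t) \<in> W"
    and x: "(x has_real_derivative x') (at t)" and y: "(y has_real_derivative y') (at t)"
  shows "((\<lambda>\<tau>. f (x \<tau>) (y \<tau>)) has_real_derivative fa (x t) (y t) * x' + fb (x t) (y t) * y') (at t)"
proof -
  have "((\<lambda>\<tau>. (x \<tau>, y \<tau>)) has_derivative (\<lambda>\<tau>. (x' * \<tau>, y' * \<tau>))) (at t)"
    using x y by (intro has_derivative_Pair) (auto simp: has_field_derivative_def)
  moreover have "((\<lambda>z. f (fst z) (snd z)) has_derivative
      (\<lambda>v. fa (x t) (y t) * fst v + fb (x t) (y t) * snd v)) (at (x t, y t))"
    using assms(1,2) by (simp add: has_partials_def)
  ultimately have "((\<lambda>\<tau>. f (x \<tau>) (y \<tau>)) has_derivative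
      (\<lambda>\<tau>. fa (x t) (y t) * (x' * \<tau>) + fb (x t) (y t) * (y' * \<tau>))) (at t)"
    by (auto dest: has_derivative_compose)
  then show ?thesis
    unfolding has_field_derivative_def by (rule has_derivative_eq_rhs) (auto simp: algebra_simps)
qed

lemma has_partials_d_alpha:
  assumes "has_partials f fa fb W" "(s, t) \<in> W"
  shows "d_alpha f s t = fa s t"
  using has_partials_chain[OF assms(1), of "\<lambda>x. x" s "\<lambda>_. t" 1 0] assms(2)
  by (auto simp: d_alpha_def intro!: DERIV_imp_deriv)

lemma has_partials_d_beta:
  assumes "has_partials f fa fb W" "(s, t) \<in> W"
  shows "d_beta f s t = fb s t"
  using has_partials_chain[OF assms(1), of "\<lambda>_. s" t "\<lambda>x. x" 0 1] assms(2)
  by (auto simp: d_beta_def intro!: DERIV_imp_deriv)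

text \<open>Iterated derivatives such as \<open>d_alpha h\<close> are known only on
  \<open>W\<close>. As \<open>W\<close> is open, agreement there suffices to pass differentials from
  a closed form to them.\<close>

lemma has_partials_cong:
  assumes "has_partials f fa fb W" "open W" "\<And>s t. (s, t) \<in> W \<Longrightarrow> g s t = f s t"
  shows "has_partials g fa fb W"
  unfolding has_partials_def
proof (intro allI impI)
  fix s t assume st: "(s, t) \<in> W"
  have "((\<lambda>z. f (fst z) (snd z)) has_derivative (\<lambda>v. fa s t * fst v + fb s t * snd v)) (at (s, t))"
    using assms(1) st by (simp add: has_partials_def)
  then show "((\<lambda>z. g (fst z) (snd z)) has_derivative (\<lambda>v. fa s t * fst v + fb s t * snd v)) (at (s, t))"
    by (rule has_derivative_transform_within_open[OF _ assms(2) st]) (use assms(3) in force)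
qed

text \<open>The suffixes of \<open>ha\<close>, \<open>hab\<close> and so on list the variables of
  differentiation. Sharing \<open>hab\<close>, \<open>haab\<close> and \<open>habb\<close> between
  hypotheses encodes the symmetry of mixed derivatives. The operators \<open>d_alpha\<close> and
  \<open>d_beta\<close> are then evaluated one order at a time.\<close>

lemma has_partials_r:
  assumes h: "has_partials h ha hb W"
    and ha: "has_partials ha haa hab W" and hb: "has_partials hb hab hbb W"
    and haa: "has_partials haa haaa haab W" and hab: "has_partials hab haab habb W"
    and hbb: "has_partials hbb habb hbbb W"
    and W: "open W" "(s, t) \<in> W"
  shows "r_m1 h s t = 1 / 2 * hbbb s t"
    and "r_m2 h s t = 1 / (2 * s) * habb s t"
    and "r_m3 h s t = 1 / (2 * s^2) * (haab s t - 1 / s * hab s t)"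
    and "r_m4 h s t = 1 / (2 * s^3) * (haaa s t - 3 / s * haa s t + 3 / s^2 * ha s t)"
proof -
  have a: "has_partials (d_alpha h) haa hab W"
    by (rule has_partials_cong[OF ha W(1) has_partials_d_alpha[OF h]])
  have b: "has_partials (d_beta h) hab hbb W"
    by (rule has_partials_cong[OF hb W(1) has_partials_d_beta[OF h]])
  have aa: "has_partials (d_alpha (d_alpha h)) haaa haab W"
    by (rule has_partials_cong[OF haa W(1) has_partials_d_alpha[OF a]])
  have ab: "has_partials (d_beta (d_alpha h)) haab habb W"
    by (rule has_partials_cong[OF hab W(1) has_partials_d_beta[OF a]])
  have bb: "has_partials (d_beta (d_beta h)) habb hbbb W"
    by (rule has_partials_cong[OF hbb W(1) has_partials_d_beta[OF b]])
  note eqs = has_partials_d_alpha[OF _ W(2)] has_partials_d_beta[OF _ W(2)]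
  show "r_m1 h s t = 1 / 2 * hbbb s t"
    by (simp add: r_m1_def eqs(2)[OF bb])
  show "r_m2 h s t = 1 / (2 * s) * habb s t"
    by (simp add: r_m2_def eqs(2)[OF ab])
  show "r_m3 h s t = 1 / (2 * s^2) * (haab s t - 1 / s * hab s t)"
    by (simp add: r_m3_def eqs(2)[OF aa] eqs(2)[OF a])
  show "r_m4 h s t = 1 / (2 * s^3) * (haaa s t - 3 / s * haa s t + 3 / s^2 * ha s t)"
    by (simp add: r_m4_def eqs(1)[OF aa] eqs(1)[OF a] eqs(1)[OF h])
qed

section \<open>Partial derivatives in the components of a covector\<close>

lemma partial_eqI:
  assumes "((\<lambda>t. f (y + t *\<^sub>R axis k 1)) has_real_derivative D) (at 0)"
  shows "partial k f y = D"
  using assms unfolding partial_def by (rule DERIV_imp_deriv)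

text \<open>A derivative at a point depends only on values nearby. This allows an inner
  \<open>partial\<close> to be replaced by a closed form valid only on an open set before the outer
  one is taken.\<close>

lemma partial_cong_open:
  assumes "open V" "y \<in> V" "\<And>z. z \<in> V \<Longrightarrow> f z = g z"
  shows "partial k f y = partial k g y"
proof -
  have "((\<lambda>t. y + t *\<^sub>R axis k 1) \<longlongrightarrow> y + 0 *\<^sub>R axis k 1) (nhds (0::real))"
    by (intro tendsto_intros filterlim_ident)
  then have "\<forall>\<^sub>F t in nhds 0. y + t *\<^sub>R axis k 1 \<in> V"
    using assms(1,2) by (simp add: topological_tendstoD)
  then have "\<forall>\<^sub>F t in nhds 0. f (y + t *\<^sub>R axis k 1) = g (y + t *\<^sub>R axis k 1)"
    by eventually_elim (use assms(3) in auto)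
  then show ?thesis
    unfolding partial_def by (rule deriv_cong_ev) simp
qed

section \<open>\<alpha>, \<beta> and the Cartan tensor in a single cotangent space\<close>

locale cotangent_metric =
  fixes a :: "('m, 'n::finite) chart \<Rightarrow> 'm \<Rightarrow> real^'n^'n"
    and b :: "('m, 'n) chart \<Rightarrow> 'm \<Rightarrow> real^'n"
    and c :: "('m, 'n) chart" and p :: 'm
  assumes symmetric: "transpose (a c p) = a c p"
    and positive: "y \<noteq> 0 \<Longrightarrow> y \<bullet> (a c p *v y) > 0"
begin

lemma alpha_eq: "alpha a c p y = sqrt (y \<bullet> (a c p *v y))"
  by (simp add: alpha_def inner_vec_def matrix_vector_mult_def sum_distrib_left mult_ac)

lemma beta_eq: "beta b c p y = b c p \<bullet> y"
  by (simp add: beta_def inner_vec_def)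

lemma alpha_pos: "y \<noteq> 0 \<Longrightarrow> alpha a c p y > 0"
  by (simp add: alpha_eq positive)

lemma Y_deriv:
  "((\<lambda>t. (a c p *v (y + t *\<^sub>R axis k 1)) $ i) has_real_derivative a c p $ i $ k) (at t)"
  by (auto simp: matrix_vector_right_distrib matrix_vector_mult_scaleR matrix_vector_mult_basis
      column_def intro!: derivative_eq_intros)

lemma beta_deriv:
  "((\<lambda>t. beta b c p (y + t *\<^sub>R axis k 1)) has_real_derivative b c p $ k) (at t)"
  by (auto simp: beta_eq inner_add_right inner_axis intro!: derivative_eq_intros)

text \<open>Along the line, \<alpha> squared is a quadratic polynomial in \<open>t\<close>; symmetry
  of \<open>a\<close> makes its linear coefficient twice the \<open>k\<close>-th component of
  \<open>Y\<close>. Its value at 0 is positive, so the square root is differentiable there.\<close>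

lemma alpha_deriv:
  assumes "y \<noteq> 0"
  shows "((\<lambda>t. alpha a c p (y + t *\<^sub>R axis k 1)) has_real_derivative
           (a c p *v y) $ k / alpha a c p y) (at 0)"
proof -
  let ?M = "a c p" and ?e = "axis k 1 :: real^'n"
  have sym: "y \<bullet> (?M *v ?e) = (?M *v y) $ k"
    by (metis dot_lmul_matrix inner_axis real_inner_1_right transpose_matrix_vector symmetric)
  have "(y + t *\<^sub>R ?e) \<bullet> (?M *v (y + t *\<^sub>R ?e)) =
      y \<bullet> (?M *v y) + 2 * t * (?M *v y) $ k + t^2 * (?e \<bullet> (?M *v ?e))" for t
    using sym by (simp add: matrix_vector_right_distrib matrix_vector_mult_scaleR inner_add_left
        inner_add_right inner_axis' power2_eq_square algebra_simps)
  then have "(\<lambda>t. alpha a c p (y + t *\<^sub>R ?e)) =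
      (\<lambda>t. sqrt (y \<bullet> (?M *v y) + 2 * t * (?M *v y) $ k + t^2 * (?e \<bullet> (?M *v ?e))))"
    by (simp add: alpha_eq)
  then show ?thesis
    using positive[OF assms] by (auto simp: alpha_eq field_simps intro!: derivative_eq_intros)
qed

lemma open_region_slice: "open {y. (p, y) \<in> region_U a b c}"
proof (cases "p \<in> fst c")
  case True
  have "continuous_on UNIV (alpha a c p)" "continuous_on UNIV (beta b c p)"
    unfolding alpha_def[abs_def] beta_def[abs_def] by (intro continuous_intros)+
  then have "open {y. y \<noteq> 0 \<and> beta b c p y > 0 \<and> alpha a c p y < beta b c p y}"
    by (intro open_Collect_conj open_Collect_less open_Collect_neq continuous_intros) auto
  with True show ?thesis by (simp add: region_U_def)
qed (simp add: region_U_def)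

lemma partial_comp:
  assumes f: "has_partials f fa fb W" and y: "y \<noteq> 0" and W: "(alpha a c p y, beta b c p y) \<in> W"
  shows "((\<lambda>t. f (alpha a c p (y + t *\<^sub>R axis k 1)) (beta b c p (y + t *\<^sub>R axis k 1)))
     has_real_derivative
       fa (alpha a c p y) (beta b c p y) * ((a c p *v y) $ k / alpha a c p y)
       + fb (alpha a c p y) (beta b c p y) * b c p $ k) (at 0)"
  using has_partials_chain[OF f _ alpha_deriv[OF y] beta_deriv] W by simp

text \<open>The lower order terms in the brackets come from differentiating inverse powers of
  \<alpha>. For the term in \<open>Y\<close> alone, the second derivative contains
  \<open>haa / \<alpha>^2\<close> and \<open>- ha / \<alpha>^3\<close>; their third-order
  contributions add up to \<open>-3 haa / \<alpha>^4\<close> and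
  \<open>3 ha / \<alpha>^5\<close>.\<close>

theorem cartan_tensor_expansion:
  fixes F :: "real^'n \<Rightarrow> real"
  assumes h: "has_partials h ha hb W"
    and ha: "has_partials ha haa hab W" and hb: "has_partials hb hab hbb W"
    and haa: "has_partials haa haaa haab W" and hab: "has_partials hab haab habb W"
    and hbb: "has_partials hbb habb hbbb W"
    and V: "open V" "0 \<notin> V" "\<And>z. z \<in> V \<Longrightarrow> (alpha a c p z, beta b c p z) \<in> W"
    and F: "\<And>z. z \<in> V \<Longrightarrow> F z = h (alpha a c p z) (beta b c p z)"
    and y: "y \<in> V"
  defines "\<alpha> \<equiv> alpha a c p y" and "\<beta> \<equiv> beta b c p y"
    and "M \<equiv> \<lambda>i j. a c p $ i $ j" and "B \<equiv> \<lambda>i. b c p $ i" and "Y \<equiv> \<lambda>i. (a c p *v y) $ i"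
  shows "- 2 * cartan_tensor F y i j k =
      1 / 2 * hbbb \<alpha> \<beta> * (B i * B j * B k)
    + 1 / (2 * \<alpha>) * habb \<alpha> \<beta> * (B i * B j * Y k + B j * B k * Y i + B k * B i * Y j)
    + 1 / (2 * \<alpha>^2) * (haab \<alpha> \<beta> - 1 / \<alpha> * hab \<alpha> \<beta>)
        * (B i * Y j * Y k + B j * Y k * Y i + B k * Y i * Y j)
    + 1 / (2 * \<alpha>^3) * (haaa \<alpha> \<beta> - 3 / \<alpha> * haa \<alpha> \<beta> + 3 / \<alpha>^2 * ha \<alpha> \<beta>)
        * (Y i * Y j * Y k)
    + 1 / (2 * \<alpha>) * hab \<alpha> \<beta> * (M i j * B k + M j k * B i + M k i * B j)
    + 1 / (2 * \<alpha>^2) * (haa \<alpha> \<beta> - 1 / \<alpha> * ha \<alpha> \<beta>)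
        * (M i j * Y k + M j k * Y i + M k i * Y j)" (is "_ = ?R")
proof -
  have nz: "z \<noteq> 0" "alpha a c p z \<noteq> 0" if "z \<in> V" for z
    using that V(2) alpha_pos[of z] by (metis, metis less_irrefl)
  \<comment> \<open>Differentiation yields entries of \<open>a\<close> with indices in the opposite
    order to some of those in the stated formulas.\<close>
  have sym: "a c p $ i $ j = a c p $ j $ i" for i j
    using symmetric by (metis transpose_def vec_lambda_beta)
  \<comment> \<open>With the inverse of \<alpha> as a variable of its own, whose derivative is again
    polynomial in \<open>u\<close> and \<open>Y\<close>, both the second and third derivatives
    reduce to polynomial identities, which \<open>algebra\<close> decides.\<close>
  define u where "u = (\<lambda>z. inverse (alpha a c p z))"
  have inverse_alpha_deriv: "((\<lambda>t. u (z + t *\<^sub>R axis k 1)) has_real_derivative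
      - ((a c p *v z) $ k * u z ^ 3)) (at 0)" if "z \<in> V" for z k
    unfolding u_def using DERIV_inverse'[OF alpha_deriv[OF nz(1)[OF that]]] nz(2)[OF that]
    by (simp add: divide_inverse power3_eq_cube mult_ac)
  have comp_deriv: "((\<lambda>t. f (alpha a c p (z + t *\<^sub>R axis k 1)) (beta b c p (z + t *\<^sub>R axis k 1)))
     has_real_derivative fa (alpha a c p z) (beta b c p z) * ((a c p *v z) $ k * u z)
       + fb (alpha a c p z) (beta b c p z) * B k) (at 0)"
    if "has_partials f fa fb W" "z \<in> V" for f fa fb z k
    using partial_comp[OF that(1) nz(1)[OF that(2)] V(3)[OF that(2)]]
    by (simp add: u_def B_def divide_inverse)
  define F1 where "F1 = (\<lambda>j z. ha (alpha a c p z) (beta b c p z) * (a c p *v z) $ j * u z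
      + hb (alpha a c p z) (beta b c p z) * B j)"
  \<comment> \<open>The Hessian of \<open>F\<close>: the factor after \<open>ha\<close> is the
    Hessian of \<alpha>, while \<beta> is linear and contributes none.\<close>
  define F2 where "F2 = (\<lambda>i j z.
      haa (alpha a c p z) (beta b c p z) * (a c p *v z) $ i * (a c p *v z) $ j * (u z * u z)
    + hab (alpha a c p z) (beta b c p z) * ((a c p *v z) $ i * B j + (a c p *v z) $ j * B i) * u z
    + hbb (alpha a c p z) (beta b c p z) * B i * B j
    + ha (alpha a c p z) (beta b c p z)
        * (M i j * u z - (a c p *v z) $ i * (a c p *v z) $ j * (u z * u z * u z)))"
  have P1: "partial j F z = F1 j z" if "z \<in> V" for j z
  proof -
    have "partial j F z = partial j (\<lambda>z. h (alpha a c p z) (beta b c p z)) z"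
      using V(1) that F by (rule partial_cong_open)
    also have "\<dots> = F1 j z"
      unfolding F1_def using partial_eqI[OF comp_deriv[OF h that]] by simp
    finally show ?thesis .
  qed
  have P2: "partial i (partial j F) z = F2 i j z" if "z \<in> V" for i j z
  proof -
    have "partial i (partial j F) z = partial i (F1 j) z"
      using V(1) that P1 by (rule partial_cong_open)
    also have "\<dots> = F2 i j z"
      unfolding F1_def
      by (rule partial_eqI, (rule derivative_eq_intros Y_deriv inverse_alpha_deriv[OF that]
            comp_deriv[OF ha that] comp_deriv[OF hb that] refl)+)
         (simp only: F2_def M_def sym[of j i] scaleR_zero_left add_0_right, algebra)
    finally show ?thesis .
  qed
  have u_eqs: "1 / \<alpha> = u y" "3 / \<alpha> = 3 * u y" "3 / \<alpha>^2 = 3 * u y ^ 2" "1 / (2 * \<alpha>) = 1 / 2 * u y"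
      "1 / (2 * \<alpha>^2) = 1 / 2 * u y ^ 2" "1 / (2 * \<alpha>^3) = 1 / 2 * u y ^ 3"
    by (simp_all add: u_def \<alpha>_def inverse_eq_divide power_divide)
  have "- 2 * cartan_tensor F y i j k = partial k (\<lambda>z. 1 / 2 * partial i (partial j F) z) y"
    by (simp add: cartan_tensor_def fundamental_tensor_def)
  also have "\<dots> = partial k (\<lambda>z. 1 / 2 * F2 i j z) y"
    using V(1) y by (rule partial_cong_open) (simp add: P2)
  also have "\<dots> = ?R"
    unfolding F2_def
    by (rule partial_eqI, (rule derivative_eq_intros Y_deriv inverse_alpha_deriv[OF y]
          comp_deriv[OF ha y] comp_deriv[OF haa y] comp_deriv[OF hab y] comp_deriv[OF hbb y]
          refl)+)
       (simp only: M_def Y_def u_eqs sym[of k i] scaleR_zero_left add_0_right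
          flip: \<alpha>_def \<beta>_def, algebra)
  finally show ?thesis .
qed

end

section \<open>Partial derivatives of \<open>\<alpha> \<beta>^2 / (\<beta> - \<alpha>)\<close> up to
  third order\<close>

definition half_plane :: "(real \<times> real) set" where
  "half_plane = {z. fst z < snd z}"

lemma open_half_plane: "open half_plane"
  unfolding half_plane_def by (intro open_Collect_less continuous_intros)

text \<open>Writing \<open>t = s + d\<close> turns every denominator into a power of the nonzero
  \<open>d\<close>, so clearing fractions leaves polynomial identities in \<open>s\<close> and
  \<open>d\<close>.\<close>

lemma has_partials_rationalI:
  assumes "\<And>s t d. t = s + d \<Longrightarrow> d \<noteq> 0 \<Longrightarrow>
    ((\<lambda>z. f (fst z) (snd z)) has_derivative (\<lambda>v. fa s t * fst v + fb s t * snd v)) (at (s, t))"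
  shows "has_partials f fa fb half_plane"
  unfolding has_partials_def
proof (intro allI impI)
  fix s t assume "(s, t) \<in> half_plane"
  with assms[of t s "t - s"]
  show "((\<lambda>z. f (fst z) (snd z)) has_derivative (\<lambda>v. fa s t * fst v + fb s t * snd v)) (at (s, t))"
    by (simp add: half_plane_def)
qed

lemma has_partials_h:
  "has_partials (\<lambda>s t. s * t^2 / (t - s))
     (\<lambda>s t. t^3 / (t - s)^2)
     (\<lambda>s t. s * t * (t - 2 * s) / (t - s)^2) half_plane"
  by (rule has_partials_rationalI, rule has_derivative_eq_rhs,
      (rule derivative_eq_intros refl | simp)+)
     (simp add: fun_eq_iff divide_simps eval_nat_numeral, (simp add: algebra_simps)?)

lemma has_partials_ha:
  "has_partials (\<lambda>s t. t^3 / (t - s)^2)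
     (\<lambda>s t. 2 * t^3 / (t - s)^3)
     (\<lambda>s t. t^2 * (t - 3 * s) / (t - s)^3) half_plane"
  by (rule has_partials_rationalI, rule has_derivative_eq_rhs,
      (rule derivative_eq_intros refl | simp)+)
     (simp add: fun_eq_iff divide_simps eval_nat_numeral, (simp add: algebra_simps)?)

lemma has_partials_hb:
  "has_partials (\<lambda>s t. s * t * (t - 2 * s) / (t - s)^2)
     (\<lambda>s t. t^2 * (t - 3 * s) / (t - s)^3)
     (\<lambda>s t. 2 * s^3 / (t - s)^3) half_plane"
  by (rule has_partials_rationalI, rule has_derivative_eq_rhs,
      (rule derivative_eq_intros refl | simp)+)
     (simp add: fun_eq_iff divide_simps eval_nat_numeral, (simp add: algebra_simps)?)

text \<open>The function is homogeneous of degree 2, so its second derivatives have degree 0 and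
  Euler's relation gives \<open>s * haaa + t * haab = 0\<close> and its analogues. Accordingly the
  third derivatives are the coefficients, up to binomial factors, of the cubic form
  \<open>6 * (t * X - s * Y)^3 / (t - s)^4\<close>.\<close>

lemma has_partials_haa:
  "has_partials (\<lambda>s t. 2 * t^3 / (t - s)^3)
     (\<lambda>s t. 6 * t^3 / (t - s)^4)
     (\<lambda>s t. - 6 * s * t^2 / (t - s)^4) half_plane"
  by (rule has_partials_rationalI, rule has_derivative_eq_rhs,
      (rule derivative_eq_intros refl | simp)+)
     (simp add: fun_eq_iff divide_simps eval_nat_numeral, (simp add: algebra_simps)?)

lemma has_partials_hab:
  "has_partials (\<lambda>s t. t^2 * (t - 3 * s) / (t - s)^3)
     (\<lambda>s t. - 6 * s * t^2 / (t - s)^4)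
     (\<lambda>s t. 6 * s^2 * t / (t - s)^4) half_plane"
  by (rule has_partials_rationalI, rule has_derivative_eq_rhs,
      (rule derivative_eq_intros refl | simp)+)
     (simp add: fun_eq_iff divide_simps eval_nat_numeral, (simp add: algebra_simps)?)

lemma has_partials_hbb:
  "has_partials (\<lambda>s t. 2 * s^3 / (t - s)^3)
     (\<lambda>s t. 6 * s^2 * t / (t - s)^4)
     (\<lambda>s t. - 6 * s^3 / (t - s)^4) half_plane"
  by (rule has_partials_rationalI, rule has_derivative_eq_rhs,
      (rule derivative_eq_intros refl | simp)+)
     (simp add: fun_eq_iff divide_simps eval_nat_numeral, (simp add: algebra_simps)?)

section \<open>Expansion of the Cartan tensor on \<open>region_U\<close> and closed forms of its
  invariants\<close>

theorem proposition5p2: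
  fixes A :: "('m::{t2_space, second_countable_topology}, 'n::finite) chart set"
    and a :: "('m, 'n) chart \<Rightarrow> 'm \<Rightarrow> real^'n^'n"
    and b :: "('m, 'n) chart \<Rightarrow> 'm \<Rightarrow> real^'n"
    and H :: "('m, 'n) chart \<Rightarrow> 'm \<Rightarrow> real^'n \<Rightarrow> real"
    and h :: "real \<Rightarrow> real \<Rightarrow> real"
  assumes "smooth_atlas A"
    and "contravariant_riemannian_metric A a"
    and "smooth_vector_field A b"
    and "h = (\<lambda>\<alpha> \<beta>. \<alpha> * \<beta>^2 / (\<beta> - \<alpha>))"
    and "alpha_beta_cartan_space_on A a b (region_U a b) h H"
  shows "cartan_tensor_coefficients A a b (region_U a b) H (r_m1 h) (r_m2 h) (r_m3 h) (r_m4 h)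
    \<and> (\<forall>c\<in>A. \<forall>(p, y) \<in> region_U a b c.
        let \<alpha> = alpha a c p y; \<beta> = beta b c p y
        in r_m1 h \<alpha> \<beta> = - 3 * \<alpha>^3 / (\<beta> - \<alpha>)^4
         \<and> r_m2 h \<alpha> \<beta> = 3 * \<alpha> * \<beta> / (\<beta> - \<alpha>)^4
         \<and> r_m3 h \<alpha> \<beta> = (4 * \<alpha> * \<beta>^3 - \<beta>^4 - 9 * \<alpha>^2 * \<beta>^2) / (2 * \<alpha>^3 * (\<beta> - \<alpha>)^4)
         \<and> r_m4 h \<alpha> \<beta> = (15 * \<alpha>^2 * \<beta>^3 + 3 * \<beta>^5 - 12 * \<alpha> * \<beta>^4)
                           / (2 * \<alpha>^5 * (\<beta> - \<alpha>)^4))"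
proof -
  have "has_partials h (\<lambda>s t. t^3 / (t - s)^2) (\<lambda>s t. s * t * (t - 2 * s) / (t - s)^2) half_plane"
    unfolding assms(4) by (rule has_partials_h)
  note partials = this has_partials_ha has_partials_hb has_partials_haa has_partials_hab
    has_partials_hbb
  note r = has_partials_r[OF partials open_half_plane]
  have region: "(alpha a c p y, beta b c p y) \<in> half_plane" if "(p, y) \<in> region_U a b c" for c p y
    using that by (simp add: region_U_def half_plane_def)
  have metric: "cotangent_metric a c p" if "c \<in> A" "(p, y) \<in> region_U a b c" for c p y
    using assms(2) that unfolding contravariant_riemannian_metric_def region_U_def
    by unfold_locales blast+
  have "cartan_tensor_coefficients A a b (region_U a b) H (r_m1 h) (r_m2 h) (r_m3 h) (r_m4 h)"
    unfolding cartan_tensor_coefficients_def Let_def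
  proof (intro exI ballI, clarify)
    fix c p y i j k
    assume c: "c \<in> A" and py: "(p, y) \<in> region_U a b c"
    interpret cotangent_metric a b c p
      using metric[OF c py] .
    have F: "H c p z = h (alpha a c p z) (beta b c p z)" if "(p, z) \<in> region_U a b c" for z
      using assms(5) c that by (auto simp: alpha_beta_cartan_space_on_def)
    \<comment> \<open>The last two summands supply the witnesses for \<rho> and \<sigma>, namely
      \<open>hab / (2 * s)\<close> and \<open>(haa - ha / s) / (2 * s^2)\<close>. They are chosen
      before \<open>c\<close>, \<open>p\<close> and \<open>y\<close>, hence written as functions of
      \<alpha> and \<beta> alone.\<close>
    show "- 2 * cartan_tensor (H c p) y i j k =
      r_m1 h (alpha a c p y) (beta b c p y) * (b c p $ i * b c p $ j * b c p $ k)
      + r_m2 h (alpha a c p y) (beta b c p y)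
        * (b c p $ i * b c p $ j * (a c p *v y) $ k + b c p $ j * b c p $ k * (a c p *v y) $ i
           + b c p $ k * b c p $ i * (a c p *v y) $ j)
      + r_m3 h (alpha a c p y) (beta b c p y)
        * (b c p $ i * (a c p *v y) $ j * (a c p *v y) $ k
           + b c p $ j * (a c p *v y) $ k * (a c p *v y) $ i
           + b c p $ k * (a c p *v y) $ i * (a c p *v y) $ j)
      + r_m4 h (alpha a c p y) (beta b c p y)
        * ((a c p *v y) $ i * (a c p *v y) $ j * (a c p *v y) $ k)
      + (\<lambda>s t. 1 / (2 * s) * (t^2 * (t - 3 * s) / (t - s)^3)) (alpha a c p y) (beta b c p y)
        * (a c p $ i $ j * b c p $ k + a c p $ j $ k * b c p $ i + a c p $ k $ i * b c p $ j)
      + (\<lambda>s t. 1 / (2 * s^2) * (2 * t^3 / (t - s)^3 - 1 / s * (t^3 / (t - s)^2)))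
          (alpha a c p y) (beta b c p y)
        * (a c p $ i $ j * (a c p *v y) $ k + a c p $ j $ k * (a c p *v y) $ i
           + a c p $ k $ i * (a c p *v y) $ j)"
      unfolding r[OF region[OF py]]
      by (rule cartan_tensor_expansion[OF partials open_region_slice])
         (use py F region in \<open>simp_all, simp add: region_U_def\<close>)
  qed
  \<comment> \<open>Here \<open>0 < s\<close> is assumed besides \<open>s < t\<close>, because the
    invariants divide by \<alpha>; on the region it holds by positivity of the metric.\<close>
  moreover have "r_m1 h s t = - 3 * s^3 / (t - s)^4"
    "r_m2 h s t = 3 * s * t / (t - s)^4"
    "r_m3 h s t = (4 * s * t^3 - t^4 - 9 * s^2 * t^2) / (2 * s^3 * (t - s)^4)"
    "r_m4 h s t = (15 * s^2 * t^3 + 3 * t^5 - 12 * s * t^4) / (2 * s^5 * (t - s)^4)"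
    if "0 < s" "s < t" for s t
  proof -
    have st: "(s, t) \<in> half_plane" using that by (simp add: half_plane_def)
    define d where "d = t - s"
    have d: "t = s + d" and nz: "s \<noteq> 0" "d \<noteq> 0" using that by (simp_all add: d_def)
    show "r_m1 h s t = - 3 * s^3 / (t - s)^4" "r_m2 h s t = 3 * s * t / (t - s)^4"
      unfolding r[OF st] using nz by (simp_all add: power2_eq_square)
    show "r_m3 h s t = (4 * s * t^3 - t^4 - 9 * s^2 * t^2) / (2 * s^3 * (t - s)^4)"
      unfolding r[OF st] unfolding d using nz
      by (simp add: divide_simps eval_nat_numeral) (simp add: algebra_simps)
    show "r_m4 h s t = (15 * s^2 * t^3 + 3 * t^5 - 12 * s * t^4) / (2 * s^5 * (t - s)^4)"
      unfolding r[OF st] unfolding d using nz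
      by (simp add: divide_simps eval_nat_numeral) (simp add: algebra_simps)
  qed
  moreover have "0 < alpha a c p y" "alpha a c p y < beta b c p y"
    if "c \<in> A" "(p, y) \<in> region_U a b c" for c p y
    using cotangent_metric.alpha_pos[OF metric[OF that]] that(2) by (simp_all add: region_U_def)
  ultimately show ?thesis
    unfolding Let_def by (intro conjI ballI; clarify?; intro conjI; assumption?) simp_all
qed

end
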